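(* Let $\alpha,\beta,\mu\in\mathbb{R}$ and let $u(x)=x^\mu$ for $x\in\mathrm{I}=(0,1)$. Then $u\in H^s_{(\alpha,\beta)}(\mathrm{I})$ for $s\ge 0$ satisfying $s<2\mu+\beta+1$.
   Context: $\mathrm{I}:=(0,1)$ and $D$ denotes the first-order derivative. For weight exponents $a,b$: $\omega^{(a,b)}(x):=(1-x)^a x^b$ and $\|g\|_{\omega^{(a,b)}}^2:=\int_0^1\omega^{(a,b)}(x)\,g(x)^2\,dx$. For an integer $m\ge 0$, $$H^m_{(\alpha,\beta)}(\mathrm{I}):=\Big\{v:\ \|v\|_{H^m_{(\alpha,\beta)}}^2:=\sum_{j=0}^m\|D^jv\|_{\omega^{(\alpha+j,\beta+j)}}^2<\infty\Big\}.$$ For non-integer $s>0$, $H^s_{(\alpha,\beta)}(\mathrm{I})$ is defined by the $K$-method of interpolation: $H^s_{(\alpha,\beta)}=[H^m_{(\alpha,\beta)},H^n_{(\alpha,\beta)}]_{\theta,2}$ with integers $0\le m<s<n$, $s=(1-\theta)m+\theta n$, $0<\theta<1$, with norm $$\|v\|_{[H^m_{(\alpha,\beta)},H^n_{(\alpha,\beta)}]_{\theta,2}}^2=\int_0^\infty t^{-2\theta}K(t,v)^2\,\frac{dt}{t},\qquad K(t,v)=\inf_{v=v_1+v_2}\big(\|v_1\|_{H^m_{(\alpha,\beta)}}+t\,\|v_2\|_{H^n_{(\alpha,\beta)}}\big).$$ Here $\alpha,\beta$ are generic weight exponents.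
   Formalization: The formal statement assumes α > −1 instead of arbitrary real α; for α ≤ −1 the claim is always false, since the integral of (1−x)^α x^(β+2μ) over (0,1) diverges at x = 1, so x^μ lies in none of the spaces. *)

theory Defs
  imports "HOL-Analysis.Analysis"
begin

abbreviation unit_ivl :: "real set" where
  "unit_ivl \<equiv> {0<..<1}"

definition weight :: "real \<Rightarrow> real \<Rightarrow> real \<Rightarrow> real" where
  "weight a b x = (1 - x) powr a * x powr b"

definition wnorm_sq :: "real \<Rightarrow> real \<Rightarrow> (real \<Rightarrow> real) \<Rightarrow> ennreal" where
  "wnorm_sq a b g = (\<integral>\<^sup>+x. ennreal (weight a b x * (g x)\<^sup>2) \<partial>lebesgue_on unit_ivl)"

definition test_function :: "(real \<Rightarrow> real) \<Rightarrow> bool" where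
  "test_function \<phi> \<longleftrightarrow>
     (\<forall>k x. (deriv ^^ k) \<phi> differentiable at x) \<and>
     (\<exists>K. compact K \<and> K \<subseteq> unit_ivl \<and> (\<forall>x. x \<notin> K \<longrightarrow> \<phi> x = 0))"

definition locally_integrable :: "(real \<Rightarrow> real) \<Rightarrow> bool" where
  "locally_integrable v \<longleftrightarrow>
     (\<forall>K. compact K \<longrightarrow> K \<subseteq> unit_ivl \<longrightarrow> v absolutely_integrable_on K)"

text \<open>The derivative \<open>D\<close> is the distributional one: \<open>g = D v\<close> on the unit interval.\<close>

definition weak_deriv :: "(real \<Rightarrow> real) \<Rightarrow> (real \<Rightarrow> real) \<Rightarrow> bool" where
  "weak_deriv v g \<longleftrightarrow>
     locally_integrable v \<and> locally_integrable g \<and>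
     (\<forall>\<phi>. test_function \<phi> \<longrightarrow>
        (LINT x:unit_ivl|lebesgue. v x * deriv \<phi> x) = - (LINT x:unit_ivl|lebesgue. g x * \<phi> x))"

text \<open>\<open>g j\<close> is a representative of \<open>D\<^sup>j v\<close> for every \<open>j \<le> m\<close>.\<close>

definition weak_derivs :: "nat \<Rightarrow> (real \<Rightarrow> real) \<Rightarrow> (nat \<Rightarrow> real \<Rightarrow> real) \<Rightarrow> bool" where
  "weak_derivs m v g \<longleftrightarrow>
     g 0 = v \<and>
     (\<forall>j\<le>m. g j \<in> borel_measurable (lebesgue_on unit_ivl)) \<and>
     (\<forall>j<m. weak_deriv (g j) (g (Suc j)))"

text \<open>
  Weak derivatives are unique up to null sets, so the sum below has the same value for all
  sequences \<open>g\<close> of weak derivatives of \<open>v\<close>. The infimum picks out this value, and it is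
  \<open>\<infinity>\<close> if \<open>v\<close> is not measurable or lacks a weak derivative of order at most \<open>m\<close>.
\<close>

definition Hnorm_sq :: "real \<Rightarrow> real \<Rightarrow> nat \<Rightarrow> (real \<Rightarrow> real) \<Rightarrow> ennreal" where
  "Hnorm_sq \<alpha> \<beta> m v =
     (INF g \<in> {g. weak_derivs m v g}. \<Sum>j\<le>m. wnorm_sq (\<alpha> + real j) (\<beta> + real j) (g j))"

definition H_int :: "real \<Rightarrow> real \<Rightarrow> nat \<Rightarrow> (real \<Rightarrow> real) set" where
  "H_int \<alpha> \<beta> m = {v. Hnorm_sq \<alpha> \<beta> m v < \<infinity>}"

definition Hnorm :: "real \<Rightarrow> real \<Rightarrow> nat \<Rightarrow> (real \<Rightarrow> real) \<Rightarrow> real" where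
  "Hnorm \<alpha> \<beta> m v = sqrt (enn2real (Hnorm_sq \<alpha> \<beta> m v))"

text \<open>\<open>K t v = \<infinity>\<close> if \<open>v\<close> has no decomposition of the required form.\<close>

definition K_functional ::
    "real \<Rightarrow> real \<Rightarrow> nat \<Rightarrow> nat \<Rightarrow> real \<Rightarrow> (real \<Rightarrow> real) \<Rightarrow> ennreal" where
  "K_functional \<alpha> \<beta> m n t v =
     (INF (v1, v2) \<in> {(v1, v2). v1 \<in> H_int \<alpha> \<beta> m \<and> v2 \<in> H_int \<alpha> \<beta> n \<and>
                         (AE x in lebesgue_on unit_ivl. v x = v1 x + v2 x)}.
        ennreal (Hnorm \<alpha> \<beta> m v1 + t * Hnorm \<alpha> \<beta> n v2))"

definition interp_norm_sq ::
    "real \<Rightarrow> real \<Rightarrow> nat \<Rightarrow> nat \<Rightarrow> real \<Rightarrow> (real \<Rightarrow> real) \<Rightarrow> ennreal" where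
  "interp_norm_sq \<alpha> \<beta> m n \<theta> v =
     (\<integral>\<^sup>+t. ennreal (t powr (- 2 * \<theta>) / t) * (K_functional \<alpha> \<beta> m n t v)\<^sup>2
        \<partial>lebesgue_on {0<..})"

definition interp_space ::
    "real \<Rightarrow> real \<Rightarrow> nat \<Rightarrow> nat \<Rightarrow> real \<Rightarrow> (real \<Rightarrow> real) set" where
  "interp_space \<alpha> \<beta> m n \<theta> = {v. interp_norm_sq \<alpha> \<beta> m n \<theta> v < \<infinity>}"

text \<open>
  For non-integer \<open>s\<close> the endpoints \<open>m < s < n\<close> of the interpolation are not prescribed;
  membership is required for every admissible choice of them.
\<close>

definition H_space :: "real \<Rightarrow> real \<Rightarrow> real \<Rightarrow> (real \<Rightarrow> real) set" where
  "H_space \<alpha> \<beta> s =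
     (if s \<in> \<nat> then H_int \<alpha> \<beta> (nat \<lfloor>s\<rfloor>)
      else {v. \<forall>m n \<theta>. real m < s \<and> s < real n \<and> 0 < \<theta> \<and> \<theta> < 1 \<and>
                 s = (1 - \<theta>) * real m + \<theta> * real n \<longrightarrow> v \<in> interp_space \<alpha> \<beta> m n \<theta>})"

end

theory Submission
  imports Defs
begin

text \<open>
  For an integer order \<open>k\<close> the \<open>j\<close>-th summand of the squared norm of \<open>x\<^sup>\<mu>\<close> is a multiple of
  \<open>\<integral> (1 - x) powr (\<alpha> + j) * x powr (2 * \<mu> + \<beta> - j)\<close>, a Beta integral that is finite for \<open>j \<le> k\<close> as
  soon as \<open>\<alpha> > -1\<close> and \<open>k < 2 * \<mu> + \<beta> + 1\<close>.

  For interpolation between the orders \<open>m < n\<close>, put \<open>N = n - m\<close> and split \<open>x\<^sup>\<mu>\<close> with the cutoff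
  \<open>\<chi> = t\<^sup>2 / (t\<^sup>2 + x\<^sup>N)\<close>: the singular part \<open>x\<^sup>\<mu> \<chi>\<close> is measured with order \<open>m\<close>, the tame part
  \<open>x\<^sup>\<mu> (1 - \<chi>)\<close> with order \<open>n\<close>. For each \<open>x\<close> this splitting \<open>v\<^sub>1 + v\<^sub>2\<close>
  of \<open>x\<^sup>\<mu>\<close> minimises \<open>x\<^sup>-\<^sup>m v\<^sub>1\<^sup>2 + t\<^sup>2 x\<^sup>-\<^sup>n v\<^sub>2\<^sup>2\<close>, the undifferentiated model problem, and it behaves well under differentiation, because
  \<open>x \<chi>' = - N \<chi> (1 - \<chi>)\<close>: each derivative of \<open>x\<^sup>\<mu> p(\<chi>)\<close> with a polynomial \<open>p\<close> is again a power
  of \<open>x\<close> times a polynomial in \<open>\<chi>\<close>, and divisibility of \<open>p\<close> by \<open>\<chi>\<close> or by \<open>1 - \<chi>\<close> is inherited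
  (\<open>has_derivative_powr_poly_cutoff\<close>, \<open>dvd_deriv_poly\<close>). So all terms of the two Sobolev norms
  are controlled, uniformly in \<open>t\<close>, by the undifferentiated factors \<open>\<chi>\<close> and \<open>1 - \<chi>\<close>
  (\<open>Hnorm_sq_powr_poly_cutoff_le\<close>).

  Interpolating the elementary bounds \<open>\<chi> \<le> min 1 (t\<^sup>2 / x\<^sup>N)\<close> and \<open>1 - \<chi> \<le> min 1 (x\<^sup>N / t\<^sup>2)\<close> gives
  \<open>K(t) \<le> C t\<^sup>\<sigma>\<close> for all \<open>t > 0\<close> and every \<open>\<sigma>\<close> in \<open>[0, 1]\<close> with \<open>m + \<sigma> N < 2 * \<mu> + \<beta> + 1\<close>
  (\<open>K_functional_powr_le\<close>). Since \<open>s = m + \<theta> N\<close> lies strictly below this bound, some \<open>\<sigma> > \<theta>\<close> is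
  admissible, which makes the interpolation integral converge at \<open>0\<close>; the choice \<open>\<sigma> = 0 < \<theta>\<close> makes
  it converge at infinity.
\<close>

section \<open>Integrals of the weights\<close>

lemma nn_integral_lebesgue_on_has_integral:
  fixes f :: "real \<Rightarrow> real"
  assumes "(f has_integral J) S" "\<And>x. x \<in> S \<Longrightarrow> 0 \<le> f x" "S \<in> sets borel"
  shows "(\<integral>\<^sup>+x. ennreal (f x) \<partial>lebesgue_on S) = ennreal J"
proof -
  have "(\<integral>\<^sup>+x. ennreal (f x) \<partial>lebesgue_on S) = (\<integral>\<^sup>+x. ennreal (indicator S x * f x) \<partial>lebesgue)"
    using assms(3)
    by (subst nn_integral_restrict_space) (auto intro!: nn_integral_cong simp: indicator_def)
  also have "\<dots> = (\<integral>\<^sup>+x. ennreal (indicator S x * f x) \<partial>lborel)"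
    by (rule nn_integral_completion)
  also have "\<dots> = ennreal J"
    using nn_integral_has_integral_lebesgue[OF assms(2,1)] .
  finally show ?thesis .
qed

lemma weight_has_integral:
  assumes "a > -1" "b > -1"
  shows "(weight a b has_integral Beta (b + 1) (a + 1)) unit_ivl"
  using has_integral_Beta_real[of "b + 1" "a + 1"] assms
  by (simp add: has_integral_Icc_iff_Ioo weight_def[abs_def] mult.commute)

lemma weight_nonneg: "0 \<le> weight a b x"
  by (simp add: weight_def)

section \<open>Classical derivatives as weak derivatives\<close>

lemma compact_unit_ivl_subset_interval:
  assumes "compact K" "K \<subseteq> unit_ivl"
  obtains a b where "0 < a" "a < b" "b < 1" "K \<subseteq> {a<..<b}"
proof (cases "K = {}")
  case True
  show ?thesis by (rule that[of "1/3" "2/3"]) (auto simp: True)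
next
  case False
  obtain p q where p: "p \<in> K" "\<And>x. x \<in> K \<Longrightarrow> p \<le> x" and q: "q \<in> K" "\<And>x. x \<in> K \<Longrightarrow> x \<le> q"
    using compact_attains_inf[OF assms(1) False] compact_attains_sup[OF assms(1) False] by metis
  have pq: "0 < p" "p \<le> q" "q < 1" using p q assms(2) by auto
  show ?thesis
  proof (rule that[of "p/2" "(q+1)/2"])
    show "K \<subseteq> {p/2<..<(q+1)/2}"
      using p(2) q(2) pq by (fastforce simp: field_simps)
  qed (use pq in \<open>auto simp: field_simps\<close>)
qed

lemma continuous_imp_locally_integrable:
  assumes "continuous_on unit_ivl v"
  shows "locally_integrable v"
  unfolding locally_integrable_def
proof (intro allI impI)
  fix K :: "real set" assume K: "compact K" "K \<subseteq> unit_ivl"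
  then obtain a b where ab: "0 < a" "a < b" "b < 1" "K \<subseteq> {a<..<b}"
    by (rule compact_unit_ivl_subset_interval)
  have "v absolutely_integrable_on {a..b}"
    by (rule absolutely_integrable_continuous_real, rule continuous_on_subset[OF assms])
      (use ab in auto)
  then show "v absolutely_integrable_on K"
    by (rule set_integrable_subset) (use ab K in \<open>auto intro: lmeasurable_compact fmeasurableD\<close>)
qed

text \<open>
  Integration by parts on a compact interval whose interior contains the support of the test
  function, so that the boundary terms vanish whatever \<open>v\<close> does near \<open>0\<close> and \<open>1\<close>.
\<close>

lemma weak_deriv_of_continuous_derivative:
  assumes deriv_v: "\<And>x. x \<in> unit_ivl \<Longrightarrow> (v has_real_derivative g x) (at x)"
    and cont_g: "continuous_on unit_ivl g"
  shows "weak_deriv v g"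
proof -
  have cont_v: "continuous_on unit_ivl v"
    using deriv_v by (meson DERIV_isCont continuous_at_imp_continuous_on)
  have "(LINT x:unit_ivl|lebesgue. v x * deriv \<phi> x) = - (LINT x:unit_ivl|lebesgue. g x * \<phi> x)"
    if \<phi>: "test_function \<phi>" for \<phi>
  proof -
    obtain K where K: "compact K" "K \<subseteq> unit_ivl" "\<And>x. x \<notin> K \<Longrightarrow> \<phi> x = 0"
      using \<phi> unfolding test_function_def by blast
    have diff: "(deriv ^^ k) \<phi> differentiable at x" for k x
      using \<phi> unfolding test_function_def by blast
    have deriv_\<phi>: "(\<phi> has_real_derivative deriv \<phi> x) (at x)" for x
      using diff[of 0 x] by (simp add: DERIV_deriv_iff_real_differentiable)
    have cont_\<phi>: "continuous_on S \<phi>" "continuous_on S (deriv \<phi>)" for S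
      using diff[of 0] diff[of 1]
      by (auto intro!: continuous_at_imp_continuous_on differentiable_imp_continuous_within)
    have deriv_0: "deriv \<phi> x = 0" if "x \<notin> K" for x
    proof -
      have "((\<lambda>_. 0) has_real_derivative deriv \<phi> x) (at x)"
        by (rule has_field_derivative_transform_within_open[OF deriv_\<phi>
            open_Compl[OF compact_imp_closed[OF K(1)]]])
          (use K(3) that in auto)
      then show ?thesis by (metis DERIV_const DERIV_unique)
    qed
    obtain a b where ab: "0 < a" "a < b" "b < 1" "K \<subseteq> {a<..<b}"
      using K(1,2) by (rule compact_unit_ivl_subset_interval)
    have sub: "{a..b} \<subseteq> unit_ivl" using ab by auto
    have to_ab: "(LINT x:unit_ivl|lebesgue. f x) = integral {a..b} f \<and> f integrable_on {a..b}"
      if "continuous_on {a..b} f" "\<And>x. x \<notin> K \<Longrightarrow> f x = 0" for f :: "real \<Rightarrow> real"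
    proof -
      have "(LINT x:unit_ivl|lebesgue. f x) = (LINT x:{a..b}|lebesgue. f x)"
        unfolding set_lebesgue_integral_def
      proof (rule Bochner_Integration.integral_cong)
        fix x
        show "indicator unit_ivl x *\<^sub>R f x = indicator {a..b} x *\<^sub>R f x"
        proof (cases "x \<in> K")
          case True
          then have "x \<in> {a..b}" "x \<in> unit_ivl" using ab(4) K(2) by auto
          then show ?thesis by simp
        qed (simp add: that(2))
      qed simp
      then show ?thesis
        using set_lebesgue_integral_eq_integral[OF absolutely_integrable_continuous_real[OF that(1)]]
        by simp
    qed
    have 1: "continuous_on {a..b} (\<lambda>x. v x * deriv \<phi> x)" "continuous_on {a..b} (\<lambda>x. g x * \<phi> x)"
      by (intro continuous_intros cont_\<phi> continuous_on_subset[OF cont_v sub]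
          continuous_on_subset[OF cont_g sub])+
    have "((\<lambda>x. v x * deriv \<phi> x + g x * \<phi> x) has_integral v b * \<phi> b - v a * \<phi> a) {a..b}"
    proof (rule fundamental_theorem_of_calculus)
      fix x assume "x \<in> {a..b}"
      then have "((\<lambda>x. v x * \<phi> x) has_real_derivative (v x * deriv \<phi> x + g x * \<phi> x)) (at x)"
        using sub by (auto intro!: derivative_eq_intros deriv_v deriv_\<phi>)
      then show "((\<lambda>x. v x * \<phi> x) has_vector_derivative (v x * deriv \<phi> x + g x * \<phi> x))
          (at x within {a..b})"
        by (simp add: has_real_derivative_iff_has_vector_derivative has_vector_derivative_at_within)
    qed (use ab in simp)
    moreover have "a \<notin> K" "b \<notin> K" using ab(4) by auto
    then have "\<phi> a = 0" "\<phi> b = 0" using K(3) by simp_all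
    ultimately have "integral {a..b} (\<lambda>x. v x * deriv \<phi> x + g x * \<phi> x) = 0"
      by (simp add: integral_unique)
    moreover note to_ab[OF 1(1)] to_ab[OF 1(2)]
    ultimately show ?thesis
      using deriv_0 K(3) by (simp add: Henstock_Kurzweil_Integration.integral_add)
  qed
  then show ?thesis
    unfolding weak_deriv_def
    using continuous_imp_locally_integrable[OF cont_v] continuous_imp_locally_integrable[OF cont_g]
    by blast
qed

text \<open>
  The infimum over representatives is estimated by one competitor. Its zeroth entry has to be
  \<open>v\<close> itself, whose values outside the unit interval are arbitrary, while \<open>h 0\<close> only agrees with
  \<open>v\<close> on the interval.
\<close>

lemma Hnorm_sq_le_of_classical_derivatives:
  assumes v: "\<And>x. x \<in> unit_ivl \<Longrightarrow> v x = h 0 x"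
    and deriv_h: "\<And>j x. x \<in> unit_ivl \<Longrightarrow> (h j has_real_derivative h (Suc j) x) (at x)"
  shows "Hnorm_sq \<alpha> \<beta> k v \<le> (\<Sum>j\<le>k. wnorm_sq (\<alpha> + real j) (\<beta> + real j) (h j))"
proof -
  define g where "g j = (if j = 0 then v else h j)" for j :: nat
  have g_eq: "g j x = h j x" if "x \<in> unit_ivl" for j x
    using v that by (simp add: g_def)
  have deriv_g: "(g j has_real_derivative g (Suc j) x) (at x)" if "x \<in> unit_ivl" for j x
    unfolding g_eq[OF that]
    by (rule has_field_derivative_transform_within_open[OF deriv_h[OF that], of unit_ivl])
      (use that g_eq in auto)
  have cont_g: "continuous_on unit_ivl (g j)" for j
    using deriv_g by (meson DERIV_isCont continuous_at_imp_continuous_on)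
  have "weak_derivs k v g"
    unfolding weak_derivs_def
    using cont_g deriv_g
    by (auto simp: g_def[of 0] intro!: weak_deriv_of_continuous_derivative
        continuous_imp_measurable_on_sets_lebesgue)
  then have "Hnorm_sq \<alpha> \<beta> k v \<le> (\<Sum>j\<le>k. wnorm_sq (\<alpha> + real j) (\<beta> + real j) (g j))"
    unfolding Hnorm_sq_def by (intro INF_lower) simp
  also have "\<dots> = (\<Sum>j\<le>k. wnorm_sq (\<alpha> + real j) (\<beta> + real j) (h j))"
    unfolding wnorm_sq_def
    by (intro sum.cong nn_integral_cong) (auto simp: g_eq)
  finally show ?thesis .
qed

section \<open>Powers multiplied by polynomials in a rational cutoff\<close>

definition cutoff :: "real \<Rightarrow> nat \<Rightarrow> real \<Rightarrow> real" where
  "cutoff c N x = c / (c + x ^ N)"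

text \<open>
  The recursion is the effect of \<open>D\<close> on \<open>x powr (\<mu> - j) * P(\<chi>)\<close> for the cutoff \<open>\<chi>\<close>, with
  \<open>x \<chi>' = - N \<chi> (1 - \<chi>)\<close>. The scale \<open>c\<close> of the cutoff does not enter: this is what makes the
  later estimates uniform in \<open>c\<close>.
\<close>

fun deriv_poly :: "real \<Rightarrow> nat \<Rightarrow> real poly \<Rightarrow> nat \<Rightarrow> real poly" where
  "deriv_poly \<mu> N p 0 = p"
| "deriv_poly \<mu> N p (Suc j) =
     smult (\<mu> - real j) (deriv_poly \<mu> N p j)
     - smult (real N) ([:0, 1:] * [:1, -1:] * pderiv (deriv_poly \<mu> N p j))"

lemma has_derivative_powr_poly_cutoff:
  assumes "c > 0" "x > 0"
  shows "((\<lambda>x. x powr (\<mu> - real j) * poly (deriv_poly \<mu> N p j) (cutoff c N x))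
      has_real_derivative
      x powr (\<mu> - real (Suc j)) * poly (deriv_poly \<mu> N p (Suc j)) (cutoff c N x)) (at x)"
proof -
  define y where "y = cutoff c N x"
  define P where "P = deriv_poly \<mu> N p j"
  have pos: "c + x ^ N > 0" using assms by (simp add: add_pos_pos)
  have pow: "x * (real N * x ^ (N - 1)) = real N * x ^ N"
    by (cases N) auto
  \<comment> \<open>The left-hand side is the form in which the quotient rule delivers the derivative of the
    cutoff.\<close>
  have euler: "- (c * (real N * x ^ (N - 1))) / (c + x ^ N)\<^sup>2 = - (real N * y * (1 - y)) / x"
  proof -
    have "1 - y = x ^ N / (c + x ^ N)"
      using pos by (simp add: y_def cutoff_def field_simps)
    then have "real N * y * (1 - y) = c * (real N * x ^ N) / (c + x ^ N)\<^sup>2"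
      by (simp add: y_def cutoff_def power2_eq_square)
    also have "\<dots> = x * (c * (real N * x ^ (N - 1)) / (c + x ^ N)\<^sup>2)"
      by (simp add: pow[symmetric])
    finally show ?thesis using assms(2) by simp
  qed
  have dcut: "(cutoff c N has_real_derivative - (real N * y * (1 - y)) / x) (at x)"
    unfolding cutoff_def[abs_def] euler[symmetric]
    using pos by (auto intro!: derivative_eq_intros simp: power2_eq_square)
  have dpoly: "((\<lambda>x. poly P (cutoff c N x)) has_real_derivative
      poly (pderiv P) y * (- (real N * y * (1 - y)) / x)) (at x)"
    using DERIV_chain2[OF poly_DERIV[of P "cutoff c N x"] dcut] by (simp add: y_def)
  have dpowr: "((\<lambda>x. x powr (\<mu> - real j)) has_real_derivative
      (\<mu> - real j) * x powr (\<mu> - real j - 1)) (at x)"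
    using assms(2) by (rule has_real_derivative_powr)
  have shift: "x powr (\<mu> - real j) = x * x powr (\<mu> - real (Suc j))"
    using assms(2) by (simp add: powr_mult_base algebra_simps)
  have step: "poly (deriv_poly \<mu> N p (Suc j)) y
      = (\<mu> - real j) * poly P y - real N * (y * (1 - y) * poly (pderiv P) y)"
    by (simp add: P_def algebra_simps)
  have "\<mu> - real j - 1 = \<mu> - real (Suc j)" by simp
  then have "(\<mu> - real j) * x powr (\<mu> - real j - 1) * poly P y
      + poly (pderiv P) y * (- (real N * y * (1 - y)) / x) * x powr (\<mu> - real j)
    = x powr (\<mu> - real (Suc j)) * poly (deriv_poly \<mu> N p (Suc j)) y"
    using assms(2) unfolding step shift by (simp only:) (simp add: field_simps)
  with DERIV_mult[OF dpowr dpoly] show ?thesis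
    unfolding y_def P_def by (simp only:)
qed

text \<open>
  The term with \<open>pderiv\<close> in the recursion carries the factor \<open>X (1 - X)\<close>, so a divisor \<open>q\<close> of this
  polynomial survives differentiation. It is applied with \<open>q\<close> equal to \<open>1\<close>, \<open>X\<close> and \<open>1 - X\<close>.
\<close>

lemma dvd_deriv_poly:
  assumes "q dvd p" "q dvd [:0, 1:] * [:1, -1:]"
  shows "q dvd deriv_poly \<mu> N p j"
proof (induction j)
  case (Suc j)
  show ?case
    unfolding deriv_poly.simps
    by (intro dvd_diff dvd_smult Suc dvd_mult2 assms(2))
qed (use assms(1) in simp)

lemma poly_le_multiple_on_unit_interval:
  fixes q r :: "real poly"
  assumes "q dvd r"
  obtains C where "\<And>y. 0 \<le> y \<Longrightarrow> y \<le> 1 \<Longrightarrow> (poly r y)\<^sup>2 \<le> C * (poly q y)\<^sup>2" "C \<ge> 0"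
proof -
  obtain k where k: "r = q * k" using assms by blast
  have "bounded (poly k ` {0..1})"
    by (intro compact_imp_bounded compact_continuous_image) (auto intro: continuous_intros)
  then obtain B where B: "\<And>y. 0 \<le> y \<Longrightarrow> y \<le> 1 \<Longrightarrow> \<bar>poly k y\<bar> \<le> B"
    by (force simp: bounded_iff)
  show ?thesis
  proof (rule that[of "B\<^sup>2"])
    fix y :: real assume "0 \<le> y" "y \<le> 1"
    then have "(poly k y)\<^sup>2 \<le> B\<^sup>2"
      using B[of y] by (intro abs_le_square_iff[THEN iffD1]) auto
    then show "(poly r y)\<^sup>2 \<le> B\<^sup>2 * (poly q y)\<^sup>2"
      by (simp add: k power_mult_distrib mult.commute[of "(poly q y)\<^sup>2"] mult_right_mono)
  qed simp
qed

text \<open>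
  The weights \<open>(1 - x)\<^sup>j x\<^sup>j\<close> of the \<open>j\<close>-th derivative absorb half of the loss \<open>x powr (- 2 * j)\<close>
  caused by differentiating; since \<open>x < 1\<close>, what remains is worst for \<open>j = k\<close>.
\<close>

lemma weight_shift_le:
  assumes "0 < x" "x < 1" "j \<le> k"
  shows "weight (\<alpha> + real j) (\<beta> + real j) x * (x powr (\<mu> - real j))\<^sup>2
    \<le> weight \<alpha> (\<beta> + 2 * \<mu> - real k) x"
proof -
  have "(x powr (\<mu> - real j))\<^sup>2 = x powr (2 * \<mu> - 2 * real j)"
    using assms(1) by (simp add: power2_eq_square powr_add[symmetric])
  then have "weight (\<alpha> + real j) (\<beta> + real j) x * (x powr (\<mu> - real j))\<^sup>2
      = (1 - x) powr (\<alpha> + real j) * x powr (\<beta> + 2 * \<mu> - real j)"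
    by (simp add: weight_def mult.assoc powr_add[symmetric] algebra_simps)
  also have "\<dots> \<le> (1 - x) powr \<alpha> * x powr (\<beta> + 2 * \<mu> - real k)"
    using assms by (intro mult_mono powr_mono') auto
  finally show ?thesis by (simp add: weight_def)
qed

text \<open>
  The factor \<open>x powr (k - \<gamma>)\<close> supplied by the bound on \<open>q(\<chi>)\<^sup>2\<close> replaces the integrand of order \<open>k\<close>
  by the integrable one of order \<open>\<gamma> < 2 * \<mu> + \<beta> + 1\<close>. The constant \<open>C\<close> is chosen before the scale
  \<open>c\<close> and the factor \<open>D\<close>, because both will depend on the parameter \<open>t\<close> of the \<open>K\<close>-functional.
\<close>

lemma Hnorm_sq_powr_poly_cutoff_le:
  fixes p q :: "real poly"
  assumes q: "q dvd p" "q dvd [:0, 1:] * [:1, -1:]"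
    and exps: "\<alpha> > -1" "\<gamma> < 2 * \<mu> + \<beta> + 1"
  obtains C where "C \<ge> 0"
    and "\<And>c D v. c > 0 \<Longrightarrow> D \<ge> 0 \<Longrightarrow>
      (\<And>x. x \<in> unit_ivl \<Longrightarrow> v x = x powr \<mu> * poly p (cutoff c N x)) \<Longrightarrow>
      (\<And>x. x \<in> unit_ivl \<Longrightarrow> (poly q (cutoff c N x))\<^sup>2 \<le> D * x powr (real k - \<gamma>)) \<Longrightarrow>
      Hnorm_sq \<alpha> \<beta> k v \<le> ennreal (C * D)"
proof -
  define P where "P = deriv_poly \<mu> N p"
  define B where "B = Beta (\<beta> + 2 * \<mu> - \<gamma> + 1) (\<alpha> + 1)"
  have "\<exists>C\<ge>0. \<forall>y. 0 \<le> y \<longrightarrow> y \<le> 1 \<longrightarrow> (poly (P j) y)\<^sup>2 \<le> C * (poly q y)\<^sup>2" for j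
    unfolding P_def by (rule poly_le_multiple_on_unit_interval[OF dvd_deriv_poly[OF q]]) blast
  then obtain A where A: "\<And>j. A j \<ge> 0"
      "\<And>j y. 0 \<le> y \<Longrightarrow> y \<le> 1 \<Longrightarrow> (poly (P j) y)\<^sup>2 \<le> A j * (poly q y)\<^sup>2"
    by metis
  have int: "(weight \<alpha> (\<beta> + 2 * \<mu> - \<gamma>) has_integral B) unit_ivl"
    unfolding B_def using exps by (intro weight_has_integral) auto
  have "B \<ge> 0" by (rule has_integral_nonneg[OF int weight_nonneg])
  show ?thesis
  proof (rule that[of "(\<Sum>j\<le>k. A j) * B"])
    show "(\<Sum>j\<le>k. A j) * B \<ge> 0" using A(1) \<open>B \<ge> 0\<close> by (simp add: sum_nonneg)
    fix c D :: real and v :: "real \<Rightarrow> real"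
    assume c: "c > 0" and D: "D \<ge> 0"
      and v: "\<And>x. x \<in> unit_ivl \<Longrightarrow> v x = x powr \<mu> * poly p (cutoff c N x)"
      and small: "\<And>x. x \<in> unit_ivl \<Longrightarrow> (poly q (cutoff c N x))\<^sup>2 \<le> D * x powr (real k - \<gamma>)"
    define h where "h j x = x powr (\<mu> - real j) * poly (P j) (cutoff c N x)" for j x
    have wh: "wnorm_sq (\<alpha> + real j) (\<beta> + real j) (h j) \<le> ennreal (A j * D * B)" if j: "j \<le> k" for j
    proof -
      have pw: "weight (\<alpha> + real j) (\<beta> + real j) x * (h j x)\<^sup>2
          \<le> A j * D * weight \<alpha> (\<beta> + 2 * \<mu> - \<gamma>) x" if x: "x \<in> unit_ivl" for x
      proof -
        have "0 \<le> cutoff c N x" "cutoff c N x \<le> 1"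
          using c x by (auto simp: cutoff_def divide_simps add_pos_pos)
        then have "(poly (P j) (cutoff c N x))\<^sup>2 \<le> A j * (poly q (cutoff c N x))\<^sup>2"
          by (rule A(2))
        also have "\<dots> \<le> A j * (D * x powr (real k - \<gamma>))"
          by (intro mult_left_mono small x A(1))
        finally have "weight (\<alpha> + real j) (\<beta> + real j) x * (x powr (\<mu> - real j))\<^sup>2
            * (poly (P j) (cutoff c N x))\<^sup>2
          \<le> weight \<alpha> (\<beta> + 2 * \<mu> - real k) x * (A j * (D * x powr (real k - \<gamma>)))"
          using x j by (intro mult_mono weight_shift_le) (auto simp: weight_nonneg)
        also have "\<dots> = A j * D * weight \<alpha> (\<beta> + 2 * \<mu> - \<gamma>) x"
        proof -
          have "x powr (\<beta> + 2 * \<mu> - \<gamma>)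
              = x powr (\<beta> + 2 * \<mu> - real k) * x powr (real k - \<gamma>)"
            unfolding powr_add[symmetric] by (rule arg_cong) simp
          then show ?thesis by (simp add: weight_def mult_ac)
        qed
        finally show ?thesis by (simp add: h_def power_mult_distrib mult.assoc)
      qed
      have "wnorm_sq (\<alpha> + real j) (\<beta> + real j) (h j)
          \<le> (\<integral>\<^sup>+x. ennreal (A j * D * weight \<alpha> (\<beta> + 2 * \<mu> - \<gamma>) x) \<partial>lebesgue_on unit_ivl)"
        unfolding wnorm_sq_def using pw by (intro nn_integral_mono ennreal_leI) simp
      also have "\<dots> = ennreal (A j * D * B)"
        using A(1) D
        by (intro nn_integral_lebesgue_on_has_integral has_integral_mult_right int)
          (auto simp: weight_nonneg)
      finally show ?thesis .
    qed
    have "Hnorm_sq \<alpha> \<beta> k v \<le> (\<Sum>j\<le>k. wnorm_sq (\<alpha> + real j) (\<beta> + real j) (h j))"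
    proof (rule Hnorm_sq_le_of_classical_derivatives)
      show "v x = h 0 x" if "x \<in> unit_ivl" for x
        using v[OF that] by (simp add: h_def P_def)
      show "(h j has_real_derivative h (Suc j) x) (at x)" if "x \<in> unit_ivl" for j x
        using has_derivative_powr_poly_cutoff[OF c, of x] that unfolding h_def P_def by simp
    qed
    also have "\<dots> \<le> (\<Sum>j\<le>k. ennreal (A j * D * B))"
      by (intro sum_mono wh) simp
    also have "\<dots> = ennreal ((\<Sum>j\<le>k. A j) * B * D)"
      using A(1) D \<open>B \<ge> 0\<close> by (simp add: sum_distrib_left sum_distrib_right mult_ac)
    finally show "Hnorm_sq \<alpha> \<beta> k v \<le> ennreal ((\<Sum>j\<le>k. A j) * B * D)" .
  qed
qed

section \<open>Integer order\<close>

text \<open>The case \<open>p = q = 1\<close>, in which the cutoff is invisible and its parameters are arbitrary.\<close>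

lemma powr_in_H_int:
  assumes "\<alpha> > -1" "\<And>x. x \<in> unit_ivl \<Longrightarrow> u x = x powr \<mu>" "real k < 2 * \<mu> + \<beta> + 1"
  shows "u \<in> H_int \<alpha> \<beta> k"
proof -
  obtain C where C: "\<And>c D v. c > 0 \<Longrightarrow> D \<ge> 0 \<Longrightarrow>
      (\<And>x. x \<in> unit_ivl \<Longrightarrow> v x = x powr \<mu> * poly 1 (cutoff c 0 x)) \<Longrightarrow>
      (\<And>x. x \<in> unit_ivl \<Longrightarrow> (poly 1 (cutoff c 0 x))\<^sup>2 \<le> D * x powr (real k - real k)) \<Longrightarrow>
      Hnorm_sq \<alpha> \<beta> k v \<le> ennreal (C * D)"
    by (rule Hnorm_sq_powr_poly_cutoff_le[OF one_dvd one_dvd assms(1,3),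
          where p = 1 and N = 0 and k = k]) blast
  have "Hnorm_sq \<alpha> \<beta> k u \<le> ennreal (C * 1)"
    by (rule C[of 1]) (use assms(2) in auto)
  then show ?thesis
    unfolding H_int_def using le_less_trans by force
qed

section \<open>The K-functional of a power\<close>

lemma Hnorm_le_of_Hnorm_sq_le:
  assumes "Hnorm_sq \<alpha> \<beta> k v \<le> ennreal (C * d\<^sup>2)" "C \<ge> 0" "d \<ge> 0"
  shows "v \<in> H_int \<alpha> \<beta> k" "Hnorm \<alpha> \<beta> k v \<le> sqrt C * d"
proof -
  show "v \<in> H_int \<alpha> \<beta> k"
    unfolding H_int_def using assms(1) le_less_trans by force
  have "enn2real (Hnorm_sq \<alpha> \<beta> k v) \<le> C * d\<^sup>2"
    using enn2real_mono[OF assms(1)] assms(2) by simp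
  then show "Hnorm \<alpha> \<beta> k v \<le> sqrt C * d"
    unfolding Hnorm_def using assms(3)
    by (metis real_sqrt_le_iff real_sqrt_mult real_sqrt_pow2 real_sqrt_unique)
qed

lemma square_le_powr:
  assumes "0 \<le> y" "y \<le> 1" "y \<le> z" "0 < z" "0 \<le> \<sigma>" "\<sigma> \<le> 1"
  shows "y\<^sup>2 \<le> z powr (\<sigma> :: real)"
proof (cases "z \<le> 1")
  case True
  have "y\<^sup>2 \<le> y" using assms by (simp add: power2_eq_square mult_left_le)
  also have "y \<le> z powr 1" using assms by simp
  also have "\<dots> \<le> z powr \<sigma>" using assms True by (intro powr_mono') auto
  finally show ?thesis .
next
  case False
  have "y\<^sup>2 \<le> 1" using assms by (simp add: power_le_one)
  also have "\<dots> \<le> z powr \<sigma>" using assms False by (simp add: ge_one_powr_ge_zero)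
  finally show ?thesis .
qed

text \<open>
  With \<open>z = t\<^sup>2 / x\<^sup>N\<close>, the cutoff is \<open>z / (z + 1)\<close>, which is at most \<open>z\<close> and at most \<open>1\<close>, hence at
  most \<open>z\<^sup>\<sigma>\<close>; its complement satisfies the same with \<open>1 / z\<close> and \<open>1 - \<sigma>\<close>.
\<close>

lemma cutoff_sq_le:
  assumes "t > 0" "x > 0" "0 \<le> \<sigma>" "\<sigma> \<le> 1"
  shows "(cutoff (t\<^sup>2) N x)\<^sup>2 \<le> (t powr \<sigma>)\<^sup>2 * x powr (- (real N * \<sigma>))"
    and "(1 - cutoff (t\<^sup>2) N x)\<^sup>2 \<le> (t powr (\<sigma> - 1))\<^sup>2 * x powr (real N * (1 - \<sigma>))"
proof -
  have pos: "t\<^sup>2 + x ^ N > 0" "t\<^sup>2 > 0" "x ^ N > 0"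
    using assms by (auto simp: add_pos_pos)
  then have nonneg: "\<not> t\<^sup>2 + x ^ N < 0" and nz: "t\<^sup>2 + x ^ N \<noteq> 0" by linarith+
  have tp: "(t powr a)\<^sup>2 = (t\<^sup>2) powr a" for a
    using assms by (simp add: powr_power power2_eq_square powr_mult)
  have xp: "x powr (real N * a) = (x ^ N) powr a" for a
    using assms by (simp add: powr_powr[symmetric] powr_realpow)
  have "(cutoff (t\<^sup>2) N x)\<^sup>2 \<le> (t\<^sup>2 / x ^ N) powr \<sigma>"
    using pos assms by (intro square_le_powr) (auto simp: cutoff_def divide_simps nonneg)
  also have "\<dots> = (t powr \<sigma>)\<^sup>2 * x powr (- (real N * \<sigma>))"
    using pos by (simp add: tp xp powr_divide powr_minus_divide)
  finally show "(cutoff (t\<^sup>2) N x)\<^sup>2 \<le> (t powr \<sigma>)\<^sup>2 * x powr (- (real N * \<sigma>))" .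
  have eq: "1 - cutoff (t\<^sup>2) N x = x ^ N / (t\<^sup>2 + x ^ N)"
    by (simp add: cutoff_def divide_simps nz)
  have "(1 - cutoff (t\<^sup>2) N x)\<^sup>2 \<le> (x ^ N / t\<^sup>2) powr (1 - \<sigma>)"
    unfolding eq
    using pos assms by (intro square_le_powr) (auto simp: divide_simps nonneg)
  also have "\<dots> = (t\<^sup>2) powr (\<sigma> - 1) * x powr (real N * (1 - \<sigma>))"
    using pos powr_minus_divide[of "t\<^sup>2" "1 - \<sigma>"] unfolding xp by (simp add: powr_divide)
  finally show "(1 - cutoff (t\<^sup>2) N x)\<^sup>2 \<le> (t powr (\<sigma> - 1))\<^sup>2 * x powr (real N * (1 - \<sigma>))"
    by (simp add: tp)
qed

text \<open>
  With \<open>\<gamma> = m + \<sigma> (n - m)\<close> the two bounds on the cutoff are exactly the hypotheses of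
  \<open>Hnorm_sq_powr_poly_cutoff_le\<close> for the orders \<open>m\<close> and \<open>n\<close>. The scale \<open>t\<^sup>2\<close> balances both parts:
  they have norms of size \<open>t\<^sup>\<sigma>\<close> and \<open>t powr (\<sigma> - 1)\<close>.
\<close>

lemma K_functional_powr_le:
  assumes \<alpha>: "\<alpha> > -1" and u: "\<And>x. x \<in> unit_ivl \<Longrightarrow> u x = x powr \<mu>"
    and mn: "m \<le> n" and \<sigma>: "0 \<le> \<sigma>" "\<sigma> \<le> 1"
    and lt: "real m + \<sigma> * real (n - m) < 2 * \<mu> + \<beta> + 1"
  obtains C where "C \<ge> 0" "\<And>t. t > 0 \<Longrightarrow> K_functional \<alpha> \<beta> m n t u \<le> ennreal (C * t powr \<sigma>)"
proof -
  define N where "N = n - m"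
  define \<gamma> where "\<gamma> = real m + \<sigma> * real N"
  have m_\<gamma>: "real m - \<gamma> = - (real N * \<sigma>)" and n_\<gamma>: "real n - \<gamma> = real N * (1 - \<sigma>)"
    using mn by (auto simp: \<gamma>_def N_def of_nat_diff algebra_simps)
  have \<gamma>: "\<gamma> < 2 * \<mu> + \<beta> + 1" using lt by (simp add: \<gamma>_def N_def)
  obtain C1 where C1: "C1 \<ge> 0" "\<And>c D v. c > 0 \<Longrightarrow> D \<ge> 0 \<Longrightarrow>
      (\<And>x. x \<in> unit_ivl \<Longrightarrow> v x = x powr \<mu> * poly [:0, 1:] (cutoff c N x)) \<Longrightarrow>
      (\<And>x. x \<in> unit_ivl \<Longrightarrow> (poly [:0, 1:] (cutoff c N x))\<^sup>2 \<le> D * x powr (real m - \<gamma>)) \<Longrightarrow>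
      Hnorm_sq \<alpha> \<beta> m v \<le> ennreal (C1 * D)"
    by (rule Hnorm_sq_powr_poly_cutoff_le[of "[:0, 1:]" "[:0, 1:]" \<alpha> \<gamma> \<mu> \<beta> N m])
      (use \<alpha> \<gamma> in \<open>auto simp del: mult_pCons_left mult_pCons_right\<close>)
  obtain C2 where C2: "C2 \<ge> 0" "\<And>c D v. c > 0 \<Longrightarrow> D \<ge> 0 \<Longrightarrow>
      (\<And>x. x \<in> unit_ivl \<Longrightarrow> v x = x powr \<mu> * poly [:1, -1:] (cutoff c N x)) \<Longrightarrow>
      (\<And>x. x \<in> unit_ivl \<Longrightarrow> (poly [:1, -1:] (cutoff c N x))\<^sup>2 \<le> D * x powr (real n - \<gamma>)) \<Longrightarrow>
      Hnorm_sq \<alpha> \<beta> n v \<le> ennreal (C2 * D)"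
    by (rule Hnorm_sq_powr_poly_cutoff_le[of "[:1, -1:]" "[:1, -1:]" \<alpha> \<gamma> \<mu> \<beta> N n])
      (use \<alpha> \<gamma> in \<open>auto simp del: mult_pCons_left mult_pCons_right\<close>)
  show ?thesis
  proof (rule that[of "sqrt C1 + sqrt C2"])
    show "sqrt C1 + sqrt C2 \<ge> 0" using C1(1) C2(1) by simp
    fix t :: real assume t: "t > 0"
    define v1 where "v1 x = x powr \<mu> * cutoff (t\<^sup>2) N x" for x
    define v2 where "v2 x = x powr \<mu> * (1 - cutoff (t\<^sup>2) N x)" for x
    have "Hnorm_sq \<alpha> \<beta> m v1 \<le> ennreal (C1 * (t powr \<sigma>)\<^sup>2)"
      by (rule C1(2)[of "t\<^sup>2"]) (use t \<sigma> cutoff_sq_le(1)[OF t] in \<open>auto simp: v1_def m_\<gamma>\<close>)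
    note 1 = Hnorm_le_of_Hnorm_sq_le[OF this C1(1) powr_ge_zero]
    have "Hnorm_sq \<alpha> \<beta> n v2 \<le> ennreal (C2 * (t powr (\<sigma> - 1))\<^sup>2)"
      by (rule C2(2)[of "t\<^sup>2"]) (use t \<sigma> cutoff_sq_le(2)[OF t] in \<open>auto simp: v2_def n_\<gamma>\<close>)
    note 2 = Hnorm_le_of_Hnorm_sq_le[OF this C2(1) powr_ge_zero]
    have "AE x in lebesgue_on unit_ivl. u x = v1 x + v2 x"
      using u by (intro AE_I2) (auto simp: v1_def v2_def algebra_simps)
    then have "K_functional \<alpha> \<beta> m n t u \<le> ennreal (Hnorm \<alpha> \<beta> m v1 + t * Hnorm \<alpha> \<beta> n v2)"
      unfolding K_functional_def using 1(1) 2(1)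
      by (intro INF_lower2[where i = "(v1, v2)"]) auto
    also have "\<dots> \<le> ennreal (sqrt C1 * t powr \<sigma> + t * (sqrt C2 * t powr (\<sigma> - 1)))"
      using 1(2) 2(2) t by (intro ennreal_leI add_mono mult_left_mono) auto
    also have "sqrt C1 * t powr \<sigma> + t * (sqrt C2 * t powr (\<sigma> - 1)) = (sqrt C1 + sqrt C2) * t powr \<sigma>"
      using t by (simp add: powr_diff algebra_simps)
    finally show "K_functional \<alpha> \<beta> m n t u \<le> ennreal ((sqrt C1 + sqrt C2) * t powr \<sigma>)" .
  qed
qed

section \<open>Membership in the interpolation space\<close>

text \<open>
  The bound by \<open>t\<^sup>\<sigma>\<close> is used on \<open>(0, 1]\<close>, where \<open>\<sigma> > \<theta>\<close> yields an exponent above \<open>-1\<close>, and the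
  constant one beyond, where \<open>\<theta> > 0\<close> yields an exponent below \<open>-1\<close>.
\<close>

lemma interp_space_memI:
  assumes C: "C0 \<ge> 0" "C1 \<ge> 0" and \<theta>: "0 < \<theta>" "\<theta> < \<sigma>"
    and large: "\<And>t. t > 0 \<Longrightarrow> K_functional \<alpha> \<beta> m n t v \<le> ennreal C0"
    and small: "\<And>t. t > 0 \<Longrightarrow> K_functional \<alpha> \<beta> m n t v \<le> ennreal (C1 * t powr \<sigma>)"
  shows "v \<in> interp_space \<alpha> \<beta> m n \<theta>"
proof -
  let ?a = "2 * \<sigma> - 2 * \<theta> - 1" and ?b = "- 2 * \<theta> - 1"
  define F where "F t = (if t \<in> {0..1} then C1\<^sup>2 * t powr ?a else 0)
      + (if t \<in> {1..} then C0\<^sup>2 * t powr ?b else 0)" for t :: real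
  have powr_int: "((\<lambda>t. C1\<^sup>2 * t powr ?a) has_integral C1\<^sup>2 * (1 powr (?a + 1) / (?a + 1))) {0..1}"
    "((\<lambda>t. C0\<^sup>2 * t powr ?b) has_integral C0\<^sup>2 * (- (1 powr (?b + 1)) / (?b + 1))) {1..}"
    using \<theta> by (intro has_integral_mult_right has_integral_powr_from_0 has_integral_powr_to_inf; simp)+
  obtain J where "(F has_integral J) UNIV"
    using has_integral_add[OF has_integral_restrict_UNIV[THEN iffD2, OF powr_int(1)]
        has_integral_restrict_UNIV[THEN iffD2, OF powr_int(2)]]
    unfolding F_def[abs_def] by blast
  then have intF: "(\<integral>\<^sup>+t. ennreal (F t) \<partial>lebesgue_on UNIV) = ennreal J"
    by (rule nn_integral_lebesgue_on_has_integral) (auto simp: F_def)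
  have bound: "ennreal (t powr (- 2 * \<theta>) / t) * (K_functional \<alpha> \<beta> m n t v)\<^sup>2 \<le> ennreal (F t)"
    if t: "t > 0" for t
  proof -
    have *: "ennreal (t powr (- 2 * \<theta>) / t) * (K_functional \<alpha> \<beta> m n t v)\<^sup>2
        \<le> ennreal (B\<^sup>2 * t powr (2 * \<tau> - 2 * \<theta> - 1))"
      if "K_functional \<alpha> \<beta> m n t v \<le> ennreal (B * t powr \<tau>)" "B \<ge> 0" for B \<tau>
    proof -
      have "ennreal (t powr (- 2 * \<theta>) / t) * (K_functional \<alpha> \<beta> m n t v)\<^sup>2
          \<le> ennreal (t powr (- 2 * \<theta>) / t) * (ennreal (B * t powr \<tau>))\<^sup>2"
        using that(1) by (intro mult_left_mono power_mono) auto
      also have "\<dots> = ennreal (t powr (- 2 * \<theta>) / t * (B * t powr \<tau>)\<^sup>2)"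
        using t that(2) by (subst ennreal_power, simp, intro ennreal_mult'[symmetric]) simp
      also have "t powr (- 2 * \<theta>) / t * (B * t powr \<tau>)\<^sup>2 = B\<^sup>2 * t powr (2 * \<tau> - 2 * \<theta> - 1)"
      proof -
        have "t powr (2 * \<tau> - 2 * \<theta> - 1) = t powr (- 2 * \<theta>) / t * (t powr \<tau>)\<^sup>2"
          using t by (simp add: powr_diff powr_minus powr_power mult.commute divide_simps)
        then show ?thesis by (simp add: power_mult_distrib)
      qed
      finally show ?thesis .
    qed
    show ?thesis
    proof (cases "t \<le> 1")
      case True
      then show ?thesis
        using *[OF small[OF t] C(2)] t by (auto simp: F_def intro: order_trans ennreal_leI)
    next
      case False
      then show ?thesis
        using *[of C0 0] large[OF t] C(1) t by (simp add: F_def)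
    qed
  qed
  have "interp_norm_sq \<alpha> \<beta> m n \<theta> v \<le> (\<integral>\<^sup>+t. ennreal (F t) \<partial>lebesgue_on {0<..})"
    unfolding interp_norm_sq_def using bound by (intro nn_integral_mono) simp
  also have "\<dots> \<le> (\<integral>\<^sup>+t. ennreal (F t) \<partial>lebesgue_on UNIV)"
    by (subst (1 2) nn_integral_restrict_space)
      (auto intro!: nn_integral_mono simp: indicator_def)
  finally show ?thesis
    unfolding interp_space_def using intF le_less_trans by fastforce
qed

theorem lemmaA1:
  fixes \<alpha> \<beta> \<mu> s :: real and u :: "real \<Rightarrow> real"
  assumes "\<alpha> > -1"
    and "\<And>x. x \<in> {0<..<1} \<Longrightarrow> u x = x powr \<mu>"
    and "s \<ge> 0"
    and "s < 2 * \<mu> + \<beta> + 1"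
  shows "u \<in> H_space \<alpha> \<beta> s"
proof (cases "s \<in> \<nat>")
  case True
  then obtain k where "s = real k" by (auto elim: Nats_cases)
  then show ?thesis
    using powr_in_H_int[of \<alpha> u \<mu> k \<beta>] assms(1,2,4) by (simp add: H_space_def)
next
  case False
  have "u \<in> interp_space \<alpha> \<beta> m n \<theta>"
    if mn: "real m < s" "s < real n" and \<theta>: "0 < \<theta>" "\<theta> < 1"
      and s: "s = (1 - \<theta>) * real m + \<theta> * real n" for m n \<theta>
  proof -
    define N where "N = real (n - m)"
    have N: "N = real n - real m" "N > 0" "m \<le> n" using mn by (auto simp: N_def)
    have s': "s = real m + \<theta> * N" using s unfolding N(1) by (simp add: algebra_simps)
    \<comment> \<open>The second term uses up only half of the gap between \<open>s\<close> and \<open>2 * \<mu> + \<beta> + 1\<close>, which keeps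
      the inequality strict; the first keeps the exponent \<open>\<theta> + \<epsilon>\<close> at most \<open>1\<close>.\<close>
    define \<epsilon> where "\<epsilon> = min (1 - \<theta>) ((2 * \<mu> + \<beta> + 1 - s) / (2 * N))"
    have \<epsilon>: "\<epsilon> > 0" "\<theta> + \<epsilon> \<le> 1" using \<theta> N(2) assms(4) by (auto simp: \<epsilon>_def)
    have "\<epsilon> * N \<le> (2 * \<mu> + \<beta> + 1 - s) / (2 * N) * N"
      using N(2) by (intro mult_right_mono) (auto simp: \<epsilon>_def)
    also have "\<dots> < 2 * \<mu> + \<beta> + 1 - s" using N(2) assms(4) by simp
    finally have lt: "real m + (\<theta> + \<epsilon>) * real (n - m) < 2 * \<mu> + \<beta> + 1"
      unfolding N_def[symmetric] using s' by (simp add: algebra_simps)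
    obtain C0 where C0: "C0 \<ge> 0"
      "\<And>t. t > 0 \<Longrightarrow> K_functional \<alpha> \<beta> m n t u \<le> ennreal (C0 * t powr 0)"
      by (rule K_functional_powr_le[of \<alpha> u \<mu> m n 0 \<beta>]) (use assms mn N(3) in auto)
    obtain C1 where C1: "C1 \<ge> 0"
      "\<And>t. t > 0 \<Longrightarrow> K_functional \<alpha> \<beta> m n t u \<le> ennreal (C1 * t powr (\<theta> + \<epsilon>))"
      by (rule K_functional_powr_le[of \<alpha> u \<mu> m n "\<theta> + \<epsilon>" \<beta>])
        (use assms(1,2) N(3) \<theta> \<epsilon> lt in auto)
    show ?thesis
      by (rule interp_space_memI[OF C0(1) C1(1) \<theta>(1), of "\<theta> + \<epsilon>"]) (use C0 C1 \<epsilon> in auto)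
  qed
  then show ?thesis using False by (simp add: H_space_def)
qed

end
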